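(* Let $l>0$ and let $V_0,V_1,\dots,V_l$ be a finite sequence of numerical semigroups in which neighbouring semigroups $V_i,V_{i+1}$ differ from one another by the addition of the Frobenius number (i.e. one of them is obtained from the other by adjoining the latter's Frobenius number). Let $H$ be a function on the set $\{V_0,\dots,V_l\}$, and let $0<p\le l$. Let $D(y_1,\dots,y_p)$ denote the determinant of the $p\times p$ matrix whose first row is $y_1,\dots,y_p$ and whose remaining entries (complex numbers or commuting variables) are fixed. Then $$\sum_{i=0}^{l-p}D\bigl(H(V_{i+1})-H(V_i),\dots,H(V_{i+p})-H(V_{i+p-1})\bigr)=D\bigl(H(V_{l-p+1})-H(V_0),\dots,H(V_l)-H(V_{p-1})\bigr).$$ Here the determinant may be regarded as a formal linear combination of the elements of its first row, and therefore a function with an arbitrary range of values is allowed as $H$.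
   Context: A numerical semigroup is a set $V\subset\mathbb Z_{\ge 0}$ that contains $0$, is closed under addition and has finite complement in $\mathbb Z_{\ge 0}$. For $V\ne\mathbb Z_{\ge 0}$ its Frobenius number is $F(V):=\max(\mathbb Z_{\ge 0}\setminus V)$, and $V\cup\{F(V)\}$ is again a numerical semigroup. The sequence $V_0,\dots,V_l$ is thus a path in the tree of numerical semigroups, the graph whose vertices are the numerical semigroups and whose edges are the pairs $(V,V\cup\{F(V)\})$. In the $j$-th position ($1\le j\le p$) the arguments of $D$ are $H(V_{i+j})-H(V_{i+j-1})$ on the left-hand side and $H(V_{l-p+j})-H(V_{j-1})$ on the right-hand side. The determinants in the sum differ only in their first row. *)

theory Defs
  imports "Jordan_Normal_Form.Determinant" "HOL-Library.Poly_Mapping"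
begin

definition numerical_semigroup :: "nat set \<Rightarrow> bool" where
  "numerical_semigroup V \<longleftrightarrow> 0 \<in> V \<and> (\<forall>x\<in>V. \<forall>y\<in>V. x + y \<in> V) \<and> finite (UNIV - V)"

text \<open>Only meaningful if \<open>V \<noteq> UNIV\<close>; all uses below are guarded accordingly.\<close>
definition frobenius :: "nat set \<Rightarrow> nat" where
  "frobenius V = Max (UNIV - V)"

definition adjoins_frobenius :: "nat set \<Rightarrow> nat set \<Rightarrow> bool" where
  "adjoins_frobenius V W \<longleftrightarrow> V \<noteq> UNIV \<and> W = V \<union> {frobenius V}"

text \<open>Rows and columns are numbered from \<open>0\<close>, so \<open>y j\<close> is the argument in position \<open>j + 1\<close>;
  the values \<open>a 0 j\<close> play no role.\<close>
definition first_row_mat :: "nat \<Rightarrow> (nat \<Rightarrow> nat \<Rightarrow> 'r) \<Rightarrow> (nat \<Rightarrow> 'r) \<Rightarrow> 'r mat" where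
  "first_row_mat p a y = mat p p (\<lambda>(i, j). if i = 0 then y j else a i j)"

definition D :: "nat \<Rightarrow> (nat \<Rightarrow> nat \<Rightarrow> 'r::comm_ring_1) \<Rightarrow> (nat \<Rightarrow> 'r) \<Rightarrow> 'r" where
  "D p a y = det (first_row_mat p a y)"

text \<open>The same determinant as a linear combination of the entries of its first row, which may
  then lie in any module with scalar multiplication \<open>scale\<close>. The cofactors along row \<open>0\<close> do not
  depend on row \<open>0\<close>, which is therefore filled with zeros.\<close>
definition D_lin ::
  "('r::comm_ring_1 \<Rightarrow> 'm \<Rightarrow> 'm) \<Rightarrow> nat \<Rightarrow> (nat \<Rightarrow> nat \<Rightarrow> 'r) \<Rightarrow> (nat \<Rightarrow> 'm) \<Rightarrow> 'm::ab_group_add" where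
  "D_lin scale p a y = (\<Sum>j<p. scale (cofactor (first_row_mat p a (\<lambda>_. 0)) 0 j) (y j))"

lemma D_lin_mult_eq_D:
  assumes "0 < p"
  shows "D_lin (*) p a y = D p a y"
proof -
  have del: "mat_delete (first_row_mat p a y) 0 j = mat_delete (first_row_mat p a (\<lambda>_. 0)) 0 j" for j
    by (rule eq_matI) (auto simp: mat_delete_def first_row_mat_def)
  have "D p a y = (\<Sum>j<p. first_row_mat p a y $$ (0, j) * cofactor (first_row_mat p a y) 0 j)"
    unfolding D_def by (rule laplace_expansion_row) (use assms in \<open>auto simp: first_row_mat_def\<close>)
  also have "\<dots> = D_lin (*) p a y"
    unfolding D_lin_def cofactor_def del
    by (rule sum.cong) (use assms in \<open>auto simp: first_row_mat_def mult.commute\<close>)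
  finally show ?thesis by simp
qed

text \<open>For values in an arbitrary set \<open>'x\<close> without any structure, the first row lies in the free
  module \<open>'x \<Rightarrow>\<^sub>0 'r\<close>, and \<open>formal x\<close> is the basis element belonging to \<open>x\<close>.\<close>
definition formal :: "'x \<Rightarrow> ('x \<Rightarrow>\<^sub>0 'r::comm_ring_1)" where
  "formal x = Poly_Mapping.single x 1"

definition formal_scale :: "'r::comm_ring_1 \<Rightarrow> ('x \<Rightarrow>\<^sub>0 'r) \<Rightarrow> ('x \<Rightarrow>\<^sub>0 'r)" where
  "formal_scale c = Poly_Mapping.map ((*) c)"

lemma lookup_formal_scale: "Poly_Mapping.lookup (formal_scale c f) x = c * Poly_Mapping.lookup f x"
  by (simp add: formal_scale_def map.rep_eq when_def)

lemma module_formal_scale: "Modules.module formal_scale"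
  by standard (rule poly_mapping_eqI; simp add: lookup_formal_scale lookup_add algebra_simps)+

end

theory Submission
  imports Defs
begin

text \<open>Write \<open>g\<close> for the composite of \<open>H\<close> and \<open>V\<close>. The
  summands differ only in their first row, so by linearity their sum is a single determinant whose
  first row is the sum of the rows; in each column consecutive differences of \<open>g\<close>
  cancel, leaving the two ends. All three claims are instances of this: the ring as a module over
  itself, an arbitrary module, and the free module on the values of \<open>H\<close>.\<close>

text \<open>\<^term>\<open>D_lin\<close> is linear in the first row, and the arguments telescope position by position.\<close>

lemma sum_D_lin_telescope:
  fixes g :: "nat \<Rightarrow> 'm::ab_group_add"
  assumes "Modules.module scale"
  shows "(\<Sum>i = 0..n. D_lin scale p a (\<lambda>j. g (i + j + 1) - g (i + j)))
    = D_lin scale p a (\<lambda>j. g (n + j + 1) - g j)"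
proof -
  interpret Modules.module scale by (fact assms)
  have telescope: "(\<Sum>i = 0..n. g (i + j + 1) - g (i + j)) = g (n + j + 1) - g j" for j
    using sum_Suc_diff[of 0 n "\<lambda>i. g (i + j)"] by simp
  show ?thesis
    \<comment> \<open>The cofactor of column \<open>j\<close> is the same for every
      \<open>i\<close>, so after the swap it factors out of the inner sum.\<close>
    unfolding D_lin_def by (subst sum.swap) (simp only: telescope flip: scale_sum_right)
qed

text \<open>Brings the ordinary determinant under the module version.\<close>

lemma module_mult: "Modules.module ((*) :: 'r::comm_ring_1 \<Rightarrow> 'r \<Rightarrow> 'r)"
  by standard (simp_all add: algebra_simps)

theorem mainTheorem8:
  fixes l p :: nat
    and V :: "nat \<Rightarrow> nat set"
    and a :: "nat \<Rightarrow> nat \<Rightarrow> 'r::comm_ring_1"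
  assumes "l > 0"
    and "\<And>i. i \<le> l \<Longrightarrow> numerical_semigroup (V i)"
    and "\<And>i. i < l \<Longrightarrow> adjoins_frobenius (V i) (V (i + 1)) \<or> adjoins_frobenius (V (i + 1)) (V i)"
    and "0 < p" and "p \<le> l"
  shows "(\<forall>H :: nat set \<Rightarrow> 'r.
            (\<Sum>i = 0..l - p. D p a (\<lambda>j. H (V (i + j + 1)) - H (V (i + j))))
            = D p a (\<lambda>j. H (V (l - p + j + 1)) - H (V j)))
       \<and> (\<forall>(scale :: 'r \<Rightarrow> 'm \<Rightarrow> 'm::ab_group_add) (H :: nat set \<Rightarrow> 'm). Modules.module scale \<longrightarrow>
            (\<Sum>i = 0..l - p. D_lin scale p a (\<lambda>j. H (V (i + j + 1)) - H (V (i + j))))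
            = D_lin scale p a (\<lambda>j. H (V (l - p + j + 1)) - H (V j)))
       \<and> (\<forall>H :: nat set \<Rightarrow> 'x.
            (\<Sum>i = 0..l - p. D_lin formal_scale p a
               (\<lambda>j. formal (H (V (i + j + 1))) - formal (H (V (i + j)))))
            = D_lin formal_scale p a (\<lambda>j. formal (H (V (l - p + j + 1))) - formal (H (V j))))"
proof (intro conjI allI impI)
  show "(\<Sum>i = 0..l - p. D p a (\<lambda>j. H (V (i + j + 1)) - H (V (i + j))))
      = D p a (\<lambda>j. H (V (l - p + j + 1)) - H (V j))" for H :: "nat set \<Rightarrow> 'r"
    using sum_D_lin_telescope[OF module_mult, of p a "\<lambda>i. H (V i)" "l - p"]
    \<comment> \<open>Laplace expansion needs a row: for \<open>p = 0\<close> the determinant is 1,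
      but \<open>D_lin\<close> is an empty sum.\<close>
    by (simp only: D_lin_mult_eq_D[OF \<open>0 < p\<close>])
\<comment> \<open>Each placeholder stands for the \<open>H\<close> bound in the goal; giving the
  shape of \<open>g\<close> settles which sequence telescopes.\<close>
qed (rule sum_D_lin_telescope[where g = "\<lambda>i. _ (V i)"], assumption,
    rule sum_D_lin_telescope[OF module_formal_scale, where g = "\<lambda>i. formal (_ (V i))"])

end
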